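(* Let $\mathcal H$ and $\mathcal G$ be real Hilbert spaces, let $f\in\Gamma_0(\mathcal H)$ be such that $\operatorname{lev}_{\leq 0}f\neq\varnothing$, let $L:\mathcal G\to\mathcal H$ be bounded and linear with adjoint $L^*$, and let $U$ be a selection of $\partial f$. Suppose that $L^{-1}(\operatorname{lev}_{\leq 0}f)\neq\varnothing$. Write $L^*UL$ for the map $y\mapsto L^*(U(Ly))$ with domain $L^{-1}(\operatorname{dom}U)$. Then: (i) $G_{f\circ L}^{L^*UL}$ is well defined, i.e. $f\circ L\in\Gamma_0(\mathcal G)$, $\operatorname{lev}_{\leq 0}(f\circ L)\neq\varnothing$ and $L^*UL$ is a selection of $\partial(f\circ L)$. (ii) $\operatorname{dom}G_{f\circ L}^{L^*UL}=L^{-1}(\operatorname{dom}G_f^U)$. (iii) For every $y\in\operatorname{dom}G_{f\circ L}^{L^*UL}$, $$L^*\big(G_f^U(Ly)\big)=L^*Ly-\frac{\|L^*ULy\|^2}{\|ULy\|^2}\Big(y-G_{f\circ L}^{L^*UL}y\Big),$$ where the second term on the right-hand side is understood to be $0$ when $f(Ly)\leq 0$ (in which case $y-G_{f\circ L}^{L^*UL}y=0$). (iv) If there exists $\alpha\in\mathbb R$ such that $L^*L=\alpha\operatorname{Id}_{\mathcal G}$ and $LL^*=\alpha\operatorname{Id}_{\mathcal H}$, then $\alpha\, G_{f\circ L}^{L^*UL}=L^*\circ G_f^U\circ L$. (v) If $L$ is invertible with $L^{-1}=L^*$, then $G_{f\circ L}^{L^*UL}=L^*\circ G_f^U\circ 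L$.
   Context: $\Gamma_0(\mathcal H)$ is the set of proper convex lower semicontinuous functions $\mathcal H\to]-\infty,+\infty]$; $\operatorname{lev}_{\leq 0}f=\{x: f(x)\leq 0\}$. $\partial f$ is the convex subdifferential, $\operatorname{dom}\partial f=\{x:\partial f(x)\neq\varnothing\}$. A selection of $\partial f$ is a map $U$ defined on some subset $\operatorname{dom}U\subset\operatorname{dom}\partial f$ with $Ux\in\partial f(x)$ for all $x\in\operatorname{dom}U$. For $f\in\Gamma_0(\mathcal H)$ with $\operatorname{lev}_{\leq 0}f\neq\varnothing$ and a selection $U$ of $\partial f$, $G_f^U$ is the single-valued map with domain $\operatorname{lev}_{\leq 0}f\cup\operatorname{dom}U$ given by $G_f^Ux=x$ if $f(x)\leq0$ and $G_f^Ux=x-\frac{f(x)}{\|Ux\|^2}Ux$ if $f(x)>0$ and $x\in\operatorname{dom}U$ (subgradients at points where $f>0$ are nonzero because $\operatorname{lev}_{\leq 0}f\neq\varnothing$). The same definitions are used on $\mathcal G$. *)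

theory Defs
  imports "HOL-Analysis.Analysis"
begin

text \<open>Real Hilbert spaces are types of sort \<open>{real_inner, complete_space}\<close>; functions with
  values in \<open>]-\<infinity>,+\<infinity>]\<close> are \<open>ereal\<close>-valued functions that never take the value \<open>-\<infinity>\<close>.\<close>

definition proper_fun :: "('a \<Rightarrow> ereal) \<Rightarrow> bool" where
  "proper_fun f \<longleftrightarrow> (\<forall>x. f x \<noteq> -\<infinity>) \<and> (\<exists>x. f x \<noteq> \<infinity>)"

text \<open>The library's \<open>convex_on\<close> and \<open>epigraph\<close> are restricted to real-valued functions.\<close>

definition convex_fun :: "('a::real_vector \<Rightarrow> ereal) \<Rightarrow> bool" where
  "convex_fun f \<longleftrightarrow> convex {(x, r::real). f x \<le> ereal r}"

text \<open>The filter is \<open>nhds x\<close>, not the punctured \<open>at x\<close>: the latter is trivial when \<open>x\<close> is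
  isolated (which happens in the zero space).\<close>

definition lower_semicont :: "('a::topological_space \<Rightarrow> ereal) \<Rightarrow> bool" where
  "lower_semicont f \<longleftrightarrow> (\<forall>x. f x \<le> Liminf (nhds x) f)"

definition Gamma0 :: "('a::{real_inner,complete_space} \<Rightarrow> ereal) set" where
  "Gamma0 = {f. proper_fun f \<and> convex_fun f \<and> lower_semicont f}"

definition lev_le0 :: "('a \<Rightarrow> ereal) \<Rightarrow> 'a set" where
  "lev_le0 f = {x. f x \<le> 0}"

definition subdiff :: "('a::real_inner \<Rightarrow> ereal) \<Rightarrow> 'a \<Rightarrow> 'a set" where
  "subdiff f x = {u. \<forall>y. ereal ((y - x) \<bullet> u) + f x \<le> f y}"

definition dom_subdiff :: "('a::real_inner \<Rightarrow> ereal) \<Rightarrow> 'a set" where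
  "dom_subdiff f = {x. subdiff f x \<noteq> {}}"

text \<open>Maps defined on a subset of a space are partial functions \<open>'a \<rightharpoonup> 'b\<close>, so that
  equality of two such maps includes equality of their domains.\<close>

definition subdiff_selection :: "('a::real_inner \<Rightarrow> ereal) \<Rightarrow> ('a \<rightharpoonup> 'a) \<Rightarrow> bool" where
  "subdiff_selection f U \<longleftrightarrow>
     dom U \<subseteq> dom_subdiff f \<and> (\<forall>x \<in> dom U. the (U x) \<in> subdiff f x)"

text \<open>When \<open>f\<close> is proper and \<open>U\<close> is a selection of its subdifferential, \<open>f x\<close> is finite for
  \<open>x \<in> dom U\<close>, so \<open>real_of_ereal\<close> loses nothing in the following definition.\<close>

definition subgrad_proj :: "('a::real_inner \<Rightarrow> ereal) \<Rightarrow> ('a \<rightharpoonup> 'a) \<Rightarrow> ('a \<rightharpoonup> 'a)" where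
  "subgrad_proj f U x =
     (if f x \<le> 0 then Some x
      else map_option (\<lambda>u. x - (real_of_ereal (f x) / (norm u)\<^sup>2) *\<^sub>R u) (U x))"

lemma dom_subgrad_proj: "dom (subgrad_proj f U) = lev_le0 f \<union> dom U"
  by (auto simp: subgrad_proj_def lev_le0_def dom_def)

lemma subgradient_nonzero:
  assumes "lev_le0 f \<noteq> {}" and "f x > 0" and "u \<in> subdiff f x"
  shows "u \<noteq> 0"
proof
  assume "u = 0"
  obtain z where "f z \<le> 0"
    using assms(1) by (auto simp: lev_le0_def)
  moreover have "f x \<le> f z"
    using assms(3) \<open>u = 0\<close> by (auto simp: subdiff_def zero_ereal_def[symmetric])
  ultimately show False
    using assms(2) by (meson leD order_trans)
qed

lemma subdiff_finite:
  assumes "proper_fun f" and "u \<in> subdiff f x"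
  shows "\<bar>f x\<bar> \<noteq> \<infinity>"
proof -
  obtain y where "f y \<noteq> \<infinity>"
    using assms(1) by (auto simp: proper_fun_def)
  moreover have "ereal ((y - x) \<bullet> u) + f x \<le> f y"
    using assms(2) by (auto simp: subdiff_def)
  ultimately have "f x \<noteq> \<infinity>" by auto
  then show ?thesis
    using assms(1) by (auto simp: proper_fun_def)
qed

text \<open>The map \<open>L\<^sup>* U L\<close>, with domain \<open>L -` dom U\<close>. Here \<open>adjoint\<close> is the library's
  choice-based adjoint, which is the Hilbert space adjoint when \<open>L\<close> is bounded and linear.\<close>

definition pullback_selection ::
  "('g::{real_inner,complete_space} \<Rightarrow> 'h::{real_inner,complete_space}) \<Rightarrow> ('h \<rightharpoonup> 'h) \<Rightarrow> ('g \<rightharpoonup> 'g)" where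
  "pullback_selection L U = map_option (adjoint L) \<circ> U \<circ> L"

lemma dom_pullback_selection: "dom (pullback_selection L U) = L -` dom U"
  by (auto simp: pullback_selection_def dom_def)

end

theory Submission
  imports Defs
begin

text \<open>The adjoint identity \<open>(L z - L y) \<bullet> u = (z - y) \<bullet> L\<^sup>* u\<close> transports subgradients of
  \<open>f\<close> at \<open>L y\<close> to subgradients of \<open>f \<circ> L\<close> at \<open>y\<close>, and the formula relating the two projections is
  the cancellation of the factor \<open>\<parallel>L\<^sup>* u\<parallel>\<^sup>2\<close>, which is nonzero since \<open>f \<circ> L\<close> has a nonempty zero
  sublevel set. When \<open>L L\<^sup>* = \<alpha> Id\<close>, the ratio \<open>\<parallel>L\<^sup>* u\<parallel>\<^sup>2 / \<parallel>u\<parallel>\<^sup>2\<close> equals \<open>\<alpha>\<close>. The adjoint exists by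
  Riesz representation: the representing vector of \<open>\<phi>\<close> minimizes \<open>\<parallel>x\<parallel>\<^sup>2 - 2 \<phi> x\<close>, and minimizing
  sequences are Cauchy by the parallelogram identity.\<close>

text \<open>First-order optimality condition for the minimizer in
  \<open>riesz_representation\<close>: near 0 the linear term governs the sign.\<close>

lemma linear_coeff_zero_of_quadratic_nonneg:
  fixes a b :: real
  assumes "\<And>t. 0 \<le> 2 * t * a + t\<^sup>2 * b"
  shows "a = 0"
proof (rule ccontr)
  assume "a \<noteq> 0"
  \<comment> \<open>The sign opposite to \<open>a\<close> makes the linear term negative; dividing
    by more than \<open>\<bar>b\<bar>\<close> lets it outweigh the quadratic term, also when
    \<open>b\<close> is 0.\<close>
  define t where "t = - a / (\<bar>b\<bar> + 1)"
  have a: "a = - t * (\<bar>b\<bar> + 1)"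
    by (simp add: t_def field_simps)
  have "2 * t * a + t\<^sup>2 * b = t\<^sup>2 * (b - 2 * \<bar>b\<bar> - 2)"
    by (subst a) (simp add: power2_eq_square algebra_simps)
  moreover have "t \<noteq> 0"
    using \<open>a \<noteq> 0\<close> by (simp add: t_def add_nonneg_eq_0_iff)
  then have "t\<^sup>2 * (b - 2 * \<bar>b\<bar> - 2) < 0"
    by (intro mult_pos_neg) auto
  ultimately show False
    using assms[of t] by simp
qed

theorem riesz_representation:
  fixes \<phi> :: "'a::{real_inner,complete_space} \<Rightarrow> real"
  assumes "bounded_linear \<phi>"
  obtains w where "\<And>x. \<phi> x = x \<bullet> w"
proof -
  interpret \<phi>: bounded_linear \<phi> by fact
  define J where "J x = x \<bullet> x - 2 * \<phi> x" for x
  define m where "m = (INF x. J x)"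
  obtain K where K: "\<And>x. \<bar>\<phi> x\<bar> \<le> norm x * K"
    using \<phi>.bounded by auto
  \<comment> \<open>The bound \<open>K\<close> gives \<open>J x\<close> \<ge>
    \<open>(norm x)\<^sup>2 - 2 * K * norm x\<close>; now complete the square.\<close>
  have "- K\<^sup>2 \<le> J x" for x
  proof -
    have "0 \<le> (norm x - K)\<^sup>2" by simp
    then show ?thesis
      using K[of x] by (simp add: J_def power2_eq_square dot_square_norm algebra_simps)
  qed
  then have "bdd_below (range J)" by (rule bdd_belowI2)
  then have m: "m \<le> J x" for x
    unfolding m_def by (simp add: cINF_lower)
  have "\<exists>x. J x < m + 1 / real (Suc n)" for n
    using cINF_less_iff[OF _ \<open>bdd_below (range J)\<close>, of "m + 1 / real (Suc n)"]
    by (simp add: m_def)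
  then obtain X where X: "\<And>n. J (X n) < m + 1 / real (Suc n)"
    by metis
  have parallelogram: "2 * J x + 2 * J y - 4 * J ((1/2) *\<^sub>R (x + y)) = (norm (x - y))\<^sup>2" for x y
    by (simp add: J_def \<phi>.add \<phi>.scaleR power2_norm_eq_inner inner_simps inner_commute field_simps)
  \<comment> \<open>The midpoint has value at least \<open>m\<close>, so near-minimizers are close
    to each other.\<close>
  have dist_le: "(norm (x - y))\<^sup>2 \<le> 2 * (J x - m) + 2 * (J y - m)" for x y
    using parallelogram[of x y] m[of "(1/2) *\<^sub>R (x + y)"] by argo
  have "Cauchy X"
    unfolding Cauchy_iff
  proof (intro allI impI)
    fix e :: real
    assume "0 < e"
    \<comment> \<open>\<open>dist_le\<close> weighs each of the two excesses by 2, so excesses below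
      a quarter of \<open>e\<^sup>2\<close> suffice.\<close>
    then obtain N where N: "1 / real (Suc N) < e\<^sup>2 / 4"
      using nat_approx_posE[of "e\<^sup>2 / 4"] by auto
    have small: "J (X n) - m < e\<^sup>2 / 4" if "N \<le> n" for n
    proof -
      have "1 / real (Suc n) \<le> 1 / real (Suc N)"
        using that by (simp add: frac_le)
      then show ?thesis using X[of n] N by linarith
    qed
    have "norm (X k - X n) < e" if "N \<le> k" "N \<le> n" for k n
    proof (rule power2_less_imp_less)
      show "(norm (X k - X n))\<^sup>2 < e\<^sup>2"
        using dist_le[of "X k" "X n"] small[OF that(1)] small[OF that(2)] by argo
    qed (use \<open>0 < e\<close> in simp)
    then show "\<exists>N. \<forall>k\<ge>N. \<forall>n\<ge>N. norm (X k - X n) < e" by blast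
  qed
  then obtain w where w: "X \<longlonglongrightarrow> w"
    by (auto simp: Cauchy_convergent_iff convergent_def)
  have "(\<lambda>n. J (X n)) \<longlonglongrightarrow> J w"
    unfolding J_def by (intro tendsto_intros \<phi>.tendsto w)
  moreover have "(\<lambda>n. m + 1 / real (Suc n)) \<longlonglongrightarrow> m + 0"
    by (intro tendsto_intros LIMSEQ_Suc[OF lim_1_over_n])
  ultimately have "J w \<le> m + 0"
    by (rule LIMSEQ_le) (use X less_imp_le in blast)
  then have "J w \<le> m" by simp
  \<comment> \<open>\<open>J (w + t *\<^sub>R v) - J w\<close> is a nonnegative quadratic in
    \<open>t\<close> with linear coefficient \<open>2 * (w \<bullet> v - \<phi> v)\<close>.\<close>
  have "w \<bullet> v - \<phi> v = 0" for v
  proof (rule linear_coeff_zero_of_quadratic_nonneg)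
    fix t :: real
    have "J w \<le> J (w + t *\<^sub>R v)"
      using \<open>J w \<le> m\<close> m order_trans by blast
    then show "0 \<le> 2 * t * (w \<bullet> v - \<phi> v) + t\<^sup>2 * (v \<bullet> v)"
      by (simp add: J_def \<phi>.add \<phi>.scaleR inner_simps inner_commute power2_eq_square algebra_simps)
  qed
  then show thesis
    by (intro that[of w]) (simp add: inner_commute)
qed

text \<open>As \<open>adjoint\<close> is a choice, it suffices that some map satisfies the identity;
  Riesz representation of \<open>\<lambda>x. L x \<bullet> y\<close> provides its value at each
  \<open>y\<close>.\<close>

lemma adjoint_hilbert:
  fixes L :: "'a::{real_inner,complete_space} \<Rightarrow> 'b::real_inner"
  assumes "bounded_linear L"
  shows "L x \<bullet> y = x \<bullet> adjoint L y"
proof -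
  have "\<exists>w. \<forall>x. L x \<bullet> y = x \<bullet> w" for y
  proof -
    have "bounded_linear (\<lambda>x. L x \<bullet> y)"
      by (rule bounded_linear_compose[OF bounded_linear_inner_left assms])
    then show ?thesis
      by (rule riesz_representation) blast
  qed
  then have "\<exists>L'. \<forall>x y. L x \<bullet> y = x \<bullet> L' y" by metis
  then show ?thesis
    unfolding adjoint_def by (rule someI2_ex) blast
qed

lemma linear_adjoint_hilbert:
  fixes L :: "'a::{real_inner,complete_space} \<Rightarrow> 'b::real_inner"
  assumes "bounded_linear L"
  shows "linear (adjoint L)"
proof
  show "adjoint L (x + y) = adjoint L x + adjoint L y" for x y
    by (rule vector_eq_rdot[THEN iffD1])
      (metis adjoint_hilbert[OF assms] inner_add_right inner_commute)
  show "adjoint L (c *\<^sub>R x) = c *\<^sub>R adjoint L x" for c x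
    by (rule vector_eq_rdot[THEN iffD1])
      (metis adjoint_hilbert[OF assms] inner_scaleR_right inner_commute)
qed

text \<open>The epigraph of \<open>f \<circ> L\<close> is the preimage of that of \<open>f\<close>
  under the linear map sending \<open>(x, r)\<close> to \<open>(L x, r)\<close>.\<close>

lemma convex_fun_compose_linear:
  assumes "convex_fun f" and "linear L"
  shows "convex_fun (f \<circ> L)"
proof -
  have "linear (\<lambda>(x, r::real). (L x, r))"
    using assms(2) by (auto simp: linear_iff)
  then have "convex ((\<lambda>(x, r::real). (L x, r)) -` {(x, r). f x \<le> ereal r})"
    using assms(1) unfolding convex_fun_def by (rule convex_linear_vimage)
  moreover have "(\<lambda>(x, r::real). (L x, r)) -` {(x, r). f x \<le> ereal r}
      = {(x, r). (f \<circ> L) x \<le> ereal r}"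
    by auto
  ultimately show ?thesis
    by (simp add: convex_fun_def)
qed

lemma lower_semicont_compose_continuous:
  assumes "lower_semicont f" and "\<And>x. isCont L x"
  shows "lower_semicont (f \<circ> L)"
  unfolding lower_semicont_def le_Liminf_iff
proof (intro allI impI)
  fix x c
  assume "c < (f \<circ> L) x"
  then have "\<forall>\<^sub>F z in nhds (L x). c < f z"
    using assms(1) by (simp add: lower_semicont_def le_Liminf_iff)
  \<comment> \<open>Continuity is stated with the punctured filter \<open>at x\<close>; the limit
    being the value \<open>L x\<close> itself, it extends to \<open>nhds x\<close>.\<close>
  moreover have "filterlim L (nhds (L x)) (nhds x)"
    using assms(2) by (simp add: isCont_def tendsto_at_iff_tendsto_nhds)
  ultimately show "\<forall>\<^sub>F z in nhds x. c < (f \<circ> L) z"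
    by (auto dest: eventually_compose_filterlim)
qed

text \<open>Composition can destroy properness if the range of \<open>L\<close> misses the domain of
  \<open>f\<close>, hence the point \<open>y\<close>.\<close>

lemma Gamma0_compose_bounded_linear:
  assumes "f \<in> Gamma0" and "bounded_linear L" and "f (L y) \<noteq> \<infinity>"
  shows "f \<circ> L \<in> Gamma0"
  using assms convex_fun_compose_linear[of f L] lower_semicont_compose_continuous[of f L]
  by (auto simp: Gamma0_def proper_fun_def bounded_linear.linear linear_continuous_at)

lemma adjoint_in_subdiff_compose:
  fixes L :: "'a::{real_inner,complete_space} \<Rightarrow> 'b::real_inner"
  assumes "bounded_linear L" and "u \<in> subdiff f (L y)"
  shows "adjoint L u \<in> subdiff (f \<circ> L) y"
  using assms(2)
  by (auto simp: subdiff_def adjoint_hilbert[OF assms(1), symmetric]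
      linear_diff[OF bounded_linear.linear[OF assms(1)]])

lemma subdiff_selection_pullback:
  assumes "bounded_linear L" and "subdiff_selection f U"
  shows "subdiff_selection (f \<circ> L) (pullback_selection L U)"
proof -
  have "adjoint L u \<in> subdiff (f \<circ> L) y" if "U (L y) = Some u" for y u
    using assms that adjoint_in_subdiff_compose by (force simp: subdiff_selection_def)
  then show ?thesis
    by (fastforce simp: subdiff_selection_def dom_subdiff_def pullback_selection_def)
qed

lemma subgrad_proj_pos:
  assumes "f x > 0" and "U x = Some u"
  shows "subgrad_proj f U x = Some (x - (real_of_ereal (f x) / (norm u)\<^sup>2) *\<^sub>R u)"
  using assms by (simp add: subgrad_proj_def flip: not_less)

theorem proposition2p9:
  fixes f :: "'h::{real_inner,complete_space} \<Rightarrow> ereal"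
    and L :: "'g::{real_inner,complete_space} \<Rightarrow> 'h"
    and U :: "'h \<rightharpoonup> 'h"
  assumes "f \<in> Gamma0"
    and "lev_le0 f \<noteq> {}"
    and "bounded_linear L"
    and "subdiff_selection f U"
    and "L -` lev_le0 f \<noteq> {}"
  defines "V \<equiv> pullback_selection L U"
  defines "GL \<equiv> subgrad_proj (f \<circ> L) V"
  shows "(f \<circ> L \<in> Gamma0 \<and> lev_le0 (f \<circ> L) \<noteq> {} \<and> subdiff_selection (f \<circ> L) V)
    \<and> dom GL = L -` dom (subgrad_proj f U)
    \<and> (\<forall>y \<in> dom GL.
         adjoint L (the (subgrad_proj f U (L y))) =
           adjoint L (L y) -
           (if f (L y) \<le> 0 then 0
            else ((norm (adjoint L (the (U (L y)))))\<^sup>2 / (norm (the (U (L y))))\<^sup>2)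
                   *\<^sub>R (y - the (GL y)))
         \<and> (f (L y) \<le> 0 \<longrightarrow> y - the (GL y) = 0))
    \<and> (\<forall>\<alpha>::real. adjoint L \<circ> L = (\<lambda>y. \<alpha> *\<^sub>R y) \<and> L \<circ> adjoint L = (\<lambda>x. \<alpha> *\<^sub>R x) \<longrightarrow>
         map_option (\<lambda>y. \<alpha> *\<^sub>R y) \<circ> GL = map_option (adjoint L) \<circ> subgrad_proj f U \<circ> L)
    \<and> (bij L \<and> inv L = adjoint L \<longrightarrow>
         GL = map_option (adjoint L) \<circ> subgrad_proj f U \<circ> L)"
proof -
  let ?G = "subgrad_proj f U"
  note lin = linear_adjoint_hilbert[OF assms(3)]
  obtain y\<^sub>0 where y0: "f (L y\<^sub>0) \<le> 0"
    using assms(5) by (auto simp: lev_le0_def)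
  then have lev: "lev_le0 (f \<circ> L) \<noteq> {}"
    by (auto simp: lev_le0_def)
  have Gamma0: "f \<circ> L \<in> Gamma0"
    using y0 by (intro Gamma0_compose_bounded_linear[OF assms(1,3), of y\<^sub>0]) auto
  have sel: "subdiff_selection (f \<circ> L) V"
    unfolding V_def by (rule subdiff_selection_pullback[OF assms(3,4)])
  have V: "V y = Some (adjoint L u)" if "U (L y) = Some u" for y u
    using that by (simp add: V_def pullback_selection_def)
  \<comment> \<open>The sublevel set of \<open>f \<circ> L\<close> is used here: that of
    \<open>f\<close> would only give \<open>u \<noteq> 0\<close>.\<close>
  have nonzero: "adjoint L u \<noteq> 0" if "f (L y) > 0" "U (L y) = Some u" for y u
  proof (rule subgradient_nonzero[OF lev])
    show "(f \<circ> L) y > 0" using that by simp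
    show "adjoint L u \<in> subdiff (f \<circ> L) y"
      using sel V[OF that(2)] by (force simp: subdiff_selection_def)
  qed
  have dom: "dom GL = L -` dom ?G"
    by (auto simp: GL_def V_def dom_subgrad_proj dom_pullback_selection lev_le0_def)
  have nonpos: "GL y = Some y" "?G (L y) = Some (L y)" if "f (L y) \<le> 0" for y
    using that by (simp_all add: GL_def subgrad_proj_def)
  have formula: "adjoint L (the (?G (L y))) = adjoint L (L y)
      - ((norm (adjoint L u))\<^sup>2 / (norm u)\<^sup>2) *\<^sub>R (y - the (GL y))"
    if "f (L y) > 0" "U (L y) = Some u" for y u
    using that nonzero[OF that] V[OF that(2)]
    by (simp add: GL_def subgrad_proj_pos linear_diff[OF lin] linear_scale[OF lin])
  have pos_dom: "\<exists>u. f (L y) > 0 \<and> U (L y) = Some u" if "y \<in> dom GL" "\<not> f (L y) \<le> 0" for y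
    using that by (auto simp: dom dom_subgrad_proj lev_le0_def)
  have scaled: "map_option (\<lambda>y. \<alpha> *\<^sub>R y) \<circ> GL = map_option (adjoint L) \<circ> ?G \<circ> L"
    if LL: "\<And>y. adjoint L (L y) = \<alpha> *\<^sub>R y" "\<And>x. L (adjoint L x) = \<alpha> *\<^sub>R x" for \<alpha>
  proof
    fix y
    consider "y \<notin> dom GL" | "f (L y) \<le> 0" | u where "y \<in> dom GL" "f (L y) > 0" "U (L y) = Some u"
      using pos_dom by blast
    then show "(map_option (\<lambda>y. \<alpha> *\<^sub>R y) \<circ> GL) y = (map_option (adjoint L) \<circ> ?G \<circ> L) y"
    proof cases
      case 1
      \<comment> \<open>Equality of partial maps includes equality of domains, so both sides must be
        \<open>None\<close> here.\<close>
      moreover from this have "L y \<notin> dom ?G" using dom by blast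
      ultimately have "GL y = None" "?G (L y) = None" by blast+
      then show ?thesis by simp
    next
      case 2
      then show ?thesis by (simp add: nonpos LL)
    next
      case 3
      have "L y \<in> dom ?G"
        using 3(1) dom by blast
      then obtain a b where ab: "GL y = Some a" "?G (L y) = Some b"
        using 3(1) by blast
      have "u \<noteq> 0"
        using nonzero[OF 3(2,3)] linear_0[OF lin] by auto
      \<comment> \<open>Move one adjoint across the inner product and use that
        \<open>L (adjoint L u)\<close> is \<open>\<alpha> *\<^sub>R u\<close>.\<close>
      moreover have "(norm (adjoint L u))\<^sup>2 = \<alpha> * (norm u)\<^sup>2"
        by (simp add: power2_norm_eq_inner adjoint_hilbert[OF assms(3), symmetric] LL)
      ultimately have "(norm (adjoint L u))\<^sup>2 / (norm u)\<^sup>2 = \<alpha>"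
        by simp
      \<comment> \<open>With ratio \<open>\<alpha>\<close>, the right-hand side of
        \<open>formula\<close> is
        \<open>\<alpha> *\<^sub>R y - \<alpha> *\<^sub>R (y - a)\<close>.\<close>
      then have "adjoint L b = \<alpha> *\<^sub>R a"
        using formula[OF 3(2,3)] ab by (simp add: LL scaleR_diff_right)
      then show ?thesis by (simp add: ab)
    qed
  qed
  \<comment> \<open>This is \<open>scaled\<close> with \<open>\<alpha>\<close> equal to 1.\<close>
  have unitary: "GL = map_option (adjoint L) \<circ> ?G \<circ> L" if "bij L" "inv L = adjoint L"
  proof -
    have "adjoint L (L y) = 1 *\<^sub>R y" "L (adjoint L x) = 1 *\<^sub>R x" for x y
      using that by (simp_all add: bij_is_inj bij_is_surj surj_f_inv_f flip: that(2))
    from scaled[OF this] show ?thesis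
      by (simp add: option.map_ident comp_def)
  qed
  show ?thesis
  proof (intro conjI ballI allI impI)
    fix y
    assume y: "y \<in> dom GL"
    show "adjoint L (the (?G (L y))) = adjoint L (L y) -
        (if f (L y) \<le> 0 then 0
         else ((norm (adjoint L (the (U (L y)))))\<^sup>2 / (norm (the (U (L y))))\<^sup>2) *\<^sub>R (y - the (GL y)))"
    proof (cases "f (L y) \<le> 0")
      case False
      then obtain u where "f (L y) > 0" "U (L y) = Some u"
        using pos_dom[OF y] by blast
      with False show ?thesis by (simp add: formula)
    qed (simp add: nonpos)
  next
    fix \<alpha> :: real
    assume "adjoint L \<circ> L = (\<lambda>y. \<alpha> *\<^sub>R y) \<and> L \<circ> adjoint L = (\<lambda>x. \<alpha> *\<^sub>R x)"
    then show "map_option (\<lambda>y. \<alpha> *\<^sub>R y) \<circ> GL = map_option (adjoint L) \<circ> ?G \<circ> L"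
      by (intro scaled) (auto simp: fun_eq_iff)
  qed (use Gamma0 lev sel dom nonpos unitary in auto)
qed

end
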